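(* Let $(D,\mathcal R)$ be a predicate $k$-CSP with literals and $1\le t\le k$. If $(D,\mathcal R)$ is $t$-wise independent, then it is also $t$-wise uniform.
   Context: A $k$-CSP $(D,\mathcal R)$ ($D$ finite, $\mathcal R$ a collection of relations $R\subseteq D^k$) is a predicate CSP with literals if $D$ is an abelian group and there is $Q\subseteq D^k$ with $\mathcal R=\{Q+b: b\in D^k\}$ (coordinatewise translates). A distribution on $D^k$ is $t$-wise $\nu$-independent if its marginal on every $t$-subset $T\subseteq[k]$ equals the product distribution $\nu^T$; it is $t$-wise uniform if every such marginal is uniform on $D^T$. The CSP is $t$-wise independent if there is a distribution $\nu$ on $D$ such that every $R\in\mathcal R$ supports (contains the support of) some $t$-wise $\nu$-independent distribution; it is $t$-wise uniform if every $R\in\mathcal R$ supports some $t$-wise uniform distribution. *)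

theory Defs
  imports "HOL-Algebra.Group" "HOL-Probability.Product_PMF"
begin

text \<open>
  The coordinate set \<open>[k]\<close> is \<open>{..<k}\<close>; tuples over \<open>D\<close> indexed by \<open>T\<close> are extensional functions,
  so \<open>D\<^sup>T\<close> is \<open>T \<rightarrow>\<^sub>E D\<close>. Probability distributions are probability mass functions.
\<close>

definition csp :: "nat \<Rightarrow> 'a set \<Rightarrow> (nat \<Rightarrow> 'a) set set \<Rightarrow> bool" where
  "csp k D \<R> \<longleftrightarrow> finite D \<and> (\<forall>R\<in>\<R>. R \<subseteq> ({..<k} \<rightarrow>\<^sub>E D))"

text \<open>The abelian group is written multiplicatively, as in \<^locale>\<open>comm_group\<close>.\<close>

definition translate ::
    "('a, 'b) monoid_scheme \<Rightarrow> nat \<Rightarrow> (nat \<Rightarrow> 'a) set \<Rightarrow> (nat \<Rightarrow> 'a) \<Rightarrow> (nat \<Rightarrow> 'a) set" where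
  "translate G k Q b = (\<lambda>x. \<lambda>i\<in>{..<k}. x i \<otimes>\<^bsub>G\<^esub> b i) ` Q"

definition predicate_csp_with_literals ::
    "('a, 'b) monoid_scheme \<Rightarrow> nat \<Rightarrow> (nat \<Rightarrow> 'a) set set \<Rightarrow> bool" where
  "predicate_csp_with_literals G k \<R> \<longleftrightarrow>
     comm_group G \<and> csp k (carrier G) \<R> \<and>
     (\<exists>Q. Q \<subseteq> ({..<k} \<rightarrow>\<^sub>E carrier G) \<and>
          \<R> = {translate G k Q b | b. b \<in> ({..<k} \<rightarrow>\<^sub>E carrier G)})"

text \<open>
  The default value \<open>undefined\<close> of \<^const>\<open>Pi_pmf\<close> is the value of a restricted function outside
  \<open>T\<close>, so \<open>Pi_pmf T undefined (\<lambda>_. \<nu>)\<close> is the product distribution \<open>\<nu>\<^sup>T\<close> on extensional functions.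
\<close>

definition t_wise_independent_pmf ::
    "nat \<Rightarrow> 'a set \<Rightarrow> nat \<Rightarrow> 'a pmf \<Rightarrow> (nat \<Rightarrow> 'a) pmf \<Rightarrow> bool" where
  "t_wise_independent_pmf k D t \<nu> \<mu> \<longleftrightarrow>
     set_pmf \<mu> \<subseteq> ({..<k} \<rightarrow>\<^sub>E D) \<and>
     (\<forall>T. T \<subseteq> {..<k} \<and> card T = t \<longrightarrow>
        map_pmf (\<lambda>x. restrict x T) \<mu> = Pi_pmf T undefined (\<lambda>_. \<nu>))"

definition t_wise_uniform_pmf ::
    "nat \<Rightarrow> 'a set \<Rightarrow> nat \<Rightarrow> (nat \<Rightarrow> 'a) pmf \<Rightarrow> bool" where
  "t_wise_uniform_pmf k D t \<mu> \<longleftrightarrow>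
     set_pmf \<mu> \<subseteq> ({..<k} \<rightarrow>\<^sub>E D) \<and>
     (\<forall>T. T \<subseteq> {..<k} \<and> card T = t \<longrightarrow>
        map_pmf (\<lambda>x. restrict x T) \<mu> = pmf_of_set (T \<rightarrow>\<^sub>E D))"

definition t_wise_independent_csp ::
    "nat \<Rightarrow> 'a set \<Rightarrow> (nat \<Rightarrow> 'a) set set \<Rightarrow> nat \<Rightarrow> bool" where
  "t_wise_independent_csp k D \<R> t \<longleftrightarrow>
     (\<exists>\<nu>. set_pmf \<nu> \<subseteq> D \<and>
          (\<forall>R\<in>\<R>. \<exists>\<mu>. t_wise_independent_pmf k D t \<nu> \<mu> \<and> set_pmf \<mu> \<subseteq> R))"

definition t_wise_uniform_csp ::
    "nat \<Rightarrow> 'a set \<Rightarrow> (nat \<Rightarrow> 'a) set set \<Rightarrow> nat \<Rightarrow> bool" where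
  "t_wise_uniform_csp k D \<R> t \<longleftrightarrow>
     (\<forall>R\<in>\<R>. \<exists>\<mu>. t_wise_uniform_pmf k D t \<mu> \<and> set_pmf \<mu> \<subseteq> R)"

end

theory Submission
  imports Defs
begin

text \<open>
  Let \<open>\<mu>\<^sub>b\<close> be the given \<open>t\<close>-wise \<open>\<nu>\<close>-independent distribution on \<open>Q + b\<close>. Then
  \<open>\<mu>\<^sub>b - b + c\<close> lives on \<open>Q + c\<close>; averaging it over a uniformly random \<open>b\<close> makes it \<open>t\<close>-wise
  uniform, because the marginal of \<open>\<mu>\<^sub>b\<close> on a \<open>t\<close>-set does not depend on \<open>b\<close>, so that \<open>b\<close> acts
  as an independent uniform shift.
\<close>

lemma PiE_dflt_undefined: "PiE_dflt A undefined B = PiE A B"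
  by (auto simp: PiE_dflt_def PiE_def Pi_def extensional_def)

text \<open>A uniform tuple has independent uniform coordinates, and forgetting some coordinates of
  a product distribution leaves the product over the remaining ones.\<close>

lemma map_pmf_restrict_pmf_of_set_PiE:
  assumes "finite A" "T \<subseteq> A" "finite D" "D \<noteq> {}"
  shows "map_pmf (\<lambda>x. restrict x T) (pmf_of_set (A \<rightarrow>\<^sub>E D)) = pmf_of_set (T \<rightarrow>\<^sub>E D)"
proof -
  have fT: "finite T" using assms finite_subset by blast
  have eq: "pmf_of_set (S \<rightarrow>\<^sub>E D) = Pi_pmf S undefined (\<lambda>_. pmf_of_set D)" if "finite S" for S :: "'a set"
    using Pi_pmf_of_set[of S "\<lambda>_. D" undefined] that assms by (simp add: PiE_dflt_undefined)
  have "(\<lambda>x::'a \<Rightarrow> 'b. restrict x T) = (\<lambda>f x. if x \<in> T then f x else undefined)"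
    by (auto simp: restrict_def)
  then show ?thesis
    using Pi_pmf_subset[OF assms(1,2), of undefined "\<lambda>_. pmf_of_set D"] by (simp add: eq fT assms)
qed

text \<open>By commutativity the map is an involution, additively
  \<open>b \<mapsto> y - b + c\<close>, so it is its own inverse. It turns a uniform shift
  \<open>b\<close> into a uniform tuple, whatever the fixed \<open>y\<close> is.\<close>

lemma (in comm_group) bij_betw_PiE_reflect:
  assumes "y \<in> T \<rightarrow> carrier G" "c \<in> T \<rightarrow> carrier G"
  shows "bij_betw (\<lambda>b. \<lambda>i\<in>T. y i \<otimes> (inv (b i) \<otimes> c i)) (T \<rightarrow>\<^sub>E carrier G) (T \<rightarrow>\<^sub>E carrier G)"
proof -
  let ?h = "\<lambda>b. \<lambda>i\<in>T. y i \<otimes> (inv (b i) \<otimes> c i)"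
  have inv: "?h (?h b) = b" if b: "b \<in> T \<rightarrow>\<^sub>E carrier G" for b
  proof
    fix i
    show "?h (?h b) i = b i"
    proof (cases "i \<in> T")
      case True
      then have [simp]: "y i \<in> carrier G" "c i \<in> carrier G" "b i \<in> carrier G"
        using assms b by auto
      \<comment> \<open>Both sides are only rearranged here: the cancellation rules are switched off
        so that the inverse pairs survive on the right, and the next step cancels them.\<close>
      have "y i \<otimes> (inv (y i \<otimes> (inv (b i) \<otimes> c i)) \<otimes> c i)
          = (y i \<otimes> inv (y i)) \<otimes> (b i \<otimes> (inv (c i) \<otimes> c i))"
        by (simp add: inv_mult m_ac del: r_inv l_inv Units_r_inv Units_l_inv)
      then show ?thesis using True by simp
    next
      case False
      then show ?thesis using b by (auto simp: PiE_def extensional_def)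
    qed
  qed
  have cl: "?h b \<in> T \<rightarrow>\<^sub>E carrier G" if "b \<in> T \<rightarrow>\<^sub>E carrier G" for b
    using that assms by (auto simp: Pi_def PiE_def)
  show ?thesis
    by (rule bij_betwI[where g = ?h]) (use inv cl in auto)
qed

theorem theoremG4:
  fixes G :: "('a, 'b) monoid_scheme" and k t :: nat and \<R> :: "(nat \<Rightarrow> 'a) set set"
  assumes "predicate_csp_with_literals G k \<R>"
    and "1 \<le> t" and "t \<le> k"
    and "t_wise_independent_csp k (carrier G) \<R> t"
  shows "t_wise_uniform_csp k (carrier G) \<R> t"
proof -
  let ?D = "carrier G"
  let ?B = "{..<k} \<rightarrow>\<^sub>E ?D"
  from assms(1) obtain Q where "comm_group G" and fin: "finite ?D" and Q: "Q \<subseteq> ?B"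
    and R: "\<R> = {translate G k Q b | b. b \<in> ?B}"
    unfolding predicate_csp_with_literals_def csp_def by blast
  interpret comm_group G by fact
  have ne: "?D \<noteq> {}" by blast
  then have finB: "finite ?B" "?B \<noteq> {}"
    using fin by (auto intro!: finite_PiE simp: PiE_eq_empty_iff)
  from assms(4) obtain \<nu> where \<nu>: "set_pmf \<nu> \<subseteq> ?D"
    and ex: "\<forall>R\<in>\<R>. \<exists>\<mu>. t_wise_independent_pmf k ?D t \<nu> \<mu> \<and> set_pmf \<mu> \<subseteq> R"
    unfolding t_wise_independent_csp_def by (elim exE conjE)
  have "\<forall>b\<in>?B. \<exists>\<mu>. t_wise_independent_pmf k ?D t \<nu> \<mu> \<and> set_pmf \<mu> \<subseteq> translate G k Q b"
  proof
    fix b assume "b \<in> ?B"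
    then have "translate G k Q b \<in> \<R>" unfolding R by blast
    with ex show "\<exists>\<mu>. t_wise_independent_pmf k ?D t \<nu> \<mu> \<and> set_pmf \<mu> \<subseteq> translate G k Q b"
      by (rule bspec)
  qed
  \<comment> \<open>The family is indexed by shifts rather than by relations, since different
    \<open>b\<close> may give the same translate.\<close>
  from bchoice[OF this] obtain m where
    m: "\<forall>b\<in>?B. t_wise_independent_pmf k ?D t \<nu> (m b) \<and> set_pmf (m b) \<subseteq> translate G k Q b"
    by (elim exE)
  have ind: "t_wise_independent_pmf k ?D t \<nu> (m b)"
    and supp: "set_pmf (m b) \<subseteq> translate G k Q b" if "b \<in> ?B" for b
    using bspec[OF m that] by simp_all
  have "\<exists>\<mu>. t_wise_uniform_pmf k ?D t \<mu> \<and> set_pmf \<mu> \<subseteq> translate G k Q c" if c: "c \<in> ?B" for c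
  proof -
    \<comment> \<open>The index set is a parameter so that the same shift can act on full tuples
      and, after restriction, on their marginals.\<close>
    let ?s = "\<lambda>T b x. \<lambda>i\<in>T. x i \<otimes>\<^bsub>G\<^esub> (inv\<^bsub>G\<^esub> (b i) \<otimes>\<^bsub>G\<^esub> c i)"
    let ?U = "pmf_of_set ?B"
    define \<rho> where "\<rho> = bind_pmf ?U (\<lambda>b. map_pmf (?s {..<k} b) (m b))"
    have shift: "?s {..<k} b x \<in> translate G k Q c" if b: "b \<in> ?B" and x: "x \<in> translate G k Q b" for b x
    proof -
      from x obtain q where q: "q \<in> Q" and xq: "x = (\<lambda>i\<in>{..<k}. q i \<otimes>\<^bsub>G\<^esub> b i)"
        unfolding translate_def by blast
      have "x i \<otimes>\<^bsub>G\<^esub> (inv\<^bsub>G\<^esub> (b i) \<otimes>\<^bsub>G\<^esub> c i) = q i \<otimes>\<^bsub>G\<^esub> c i" if i: "i < k" for i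
      proof -
        have [simp]: "q i \<in> ?D" "b i \<in> ?D" "c i \<in> ?D"
          using i q Q b c by auto
        have "(q i \<otimes>\<^bsub>G\<^esub> b i) \<otimes>\<^bsub>G\<^esub> (inv\<^bsub>G\<^esub> (b i) \<otimes>\<^bsub>G\<^esub> c i)
            = q i \<otimes>\<^bsub>G\<^esub> ((b i \<otimes>\<^bsub>G\<^esub> inv\<^bsub>G\<^esub> (b i)) \<otimes>\<^bsub>G\<^esub> c i)"
          by (simp add: m_assoc del: r_inv Units_r_inv)
        then show ?thesis using i by (simp add: xq)
      qed
      then have "?s {..<k} b x = (\<lambda>i\<in>{..<k}. q i \<otimes>\<^bsub>G\<^esub> c i)"
        by (auto simp: restrict_def)
      then show ?thesis using q unfolding translate_def by blast
    qed
    have sub: "set_pmf \<rho> \<subseteq> translate G k Q c"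
    proof
      fix z assume "z \<in> set_pmf \<rho>"
      then obtain b x where "b \<in> ?B" "x \<in> set_pmf (m b)" "z = ?s {..<k} b x"
        unfolding \<rho>_def using finB by auto
      then show "z \<in> translate G k Q c" using shift supp by blast
    qed
    have "translate G k Q c \<subseteq> ?B"
      unfolding translate_def using Q c by (auto simp: PiE_def Pi_def subset_iff)
    with sub have "set_pmf \<rho> \<subseteq> ?B" by blast
    moreover have "map_pmf (\<lambda>x. restrict x T) \<rho> = pmf_of_set (T \<rightarrow>\<^sub>E ?D)"
      if T: "T \<subseteq> {..<k}" and ct: "card T = t" for T
    proof -
      let ?P = "Pi_pmf T undefined (\<lambda>_. \<nu>)"
      have fT: "finite T" using T finite_subset by blast
      \<comment> \<open>Restriction commutes with the shift, so \<open>m b\<close> enters only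
        through its marginal on \<open>T\<close>, which is \<open>?P\<close> for every
        \<open>b\<close>. On the right, \<open>b\<close> survives only in the shift.\<close>
      have "map_pmf (\<lambda>x. restrict x T) (map_pmf (?s {..<k} b) (m b)) = map_pmf (?s T b) ?P"
        if "b \<in> ?B" for b
      proof -
        have "?P = map_pmf (\<lambda>x. restrict x T) (m b)"
          using ind[OF that] T ct unfolding t_wise_independent_pmf_def by metis
        moreover have "restrict (?s {..<k} b x) T = ?s T b (restrict x T)" for x
          using T by (auto simp: restrict_def fun_eq_iff)
        ultimately show ?thesis by (simp add: map_pmf_comp)
      qed
      then have "map_pmf (\<lambda>x. restrict x T) \<rho> = bind_pmf ?U (\<lambda>b. map_pmf (?s T b) ?P)"
        unfolding \<rho>_def map_bind_pmf using finB by (intro bind_pmf_cong) auto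
      \<comment> \<open>Now \<open>y\<close> and \<open>b\<close> are independent, so
        \<open>y\<close> can be drawn first and held fixed while \<open>b\<close> varies.\<close>
      also have "\<dots> = bind_pmf ?P (\<lambda>y. map_pmf (\<lambda>b. ?s T b y) ?U)"
        unfolding map_pmf_def by (rule bind_commute_pmf)
      also have "\<dots> = bind_pmf ?P (\<lambda>y. pmf_of_set (T \<rightarrow>\<^sub>E ?D))"
      proof (rule bind_pmf_cong[OF refl])
        \<comment> \<open>Since \<open>\<nu>\<close> lives on the group, so do the entries of every
          \<open>y\<close> in the support of \<open>?P\<close>, as the reflection requires.\<close>
        fix y assume "y \<in> set_pmf ?P"
        then have y: "y \<in> T \<rightarrow> ?D"
          using \<nu> fT by (auto simp: set_Pi_pmf PiE_dflt_def)
        have cT: "c \<in> T \<rightarrow> ?D" using c T by auto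
        \<comment> \<open>The shift on \<open>T\<close> reads only the coordinates of
          \<open>b\<close> in \<open>T\<close>, so \<open>b\<close> may be replaced by its
          restriction, which is uniform.\<close>
        have "map_pmf (\<lambda>b. ?s T b y) ?U = map_pmf (\<lambda>b. ?s T b y) (map_pmf (\<lambda>b. restrict b T) ?U)"
          by (simp add: map_pmf_comp cong: restrict_cong)
        also have "\<dots> = map_pmf (\<lambda>b. ?s T b y) (pmf_of_set (T \<rightarrow>\<^sub>E ?D))"
          by (simp add: map_pmf_restrict_pmf_of_set_PiE T fin ne)
        also have "\<dots> = pmf_of_set (T \<rightarrow>\<^sub>E ?D)"
          using fT fin ne
          by (intro map_pmf_of_set_bij_betw bij_betw_PiE_reflect y cT)
            (auto intro!: finite_PiE simp: PiE_eq_empty_iff)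
        finally show "map_pmf (\<lambda>b. ?s T b y) ?U = pmf_of_set (T \<rightarrow>\<^sub>E ?D)" .
      qed
      finally show ?thesis by simp
    qed
    ultimately show ?thesis
      using sub unfolding t_wise_uniform_pmf_def by blast
  qed
  then show ?thesis
    unfolding t_wise_uniform_csp_def R by blast
qed

end
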